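(* Let $A$ and $B$ be positive rational numbers and let $m$ and $n$ be natural numbers greater than $1$ such that $\sqrt[m]{A}$ and $\sqrt[n]{B}$ are both irreducible. Suppose that either (i) $m \neq n$, or (ii) $m = n$ and $\sqrt[n]{\frac{A}{B}}$ is irrational. Then the three numbers $1$, $\sqrt[m]{A}$, and $\sqrt[n]{B}$ are linearly independent over the rational numbers.
   Context: Natural numbers are the positive integers, and $\sqrt[n]{A}$ denotes the positive real $n$-th root. For a positive rational number $A$ and a natural number $n \ge 2$, the radical $\sqrt[n]{A}$ is called irreducible if there do not exist a natural number $m < n$ (with $m=1$ allowed, $\sqrt[1]{B}=B$) and a positive rational number $B$ such that $\sqrt[n]{A} = \sqrt[m]{B}$. *)

theory Defs
  imports "HOL-Analysis.Analysis"
begin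

global_interpretation rat_real: vector_space "\<lambda>(q::rat) (x::real). of_rat q * x"
  by unfold_locales (simp_all add: of_rat_add of_rat_mult algebra_simps)

text \<open>The bound \<open>1 \<le> m\<close> is needed because \<open>root 0 x = 0\<close> in the library.
  The notion is only meant for \<open>2 \<le> n\<close> and \<open>0 < A\<close>.\<close>

definition irreducible_radical :: "nat \<Rightarrow> rat \<Rightarrow> bool" where
  "irreducible_radical n A \<longleftrightarrow>
     \<not> (\<exists>(m::nat) (B::rat). 1 \<le> m \<and> m < n \<and> 0 < B \<and>
          root n (of_rat A) = root m (of_rat B))"

end

theory Submission
  imports Defs "HOL-Computational_Algebra.Computational_Algebra"
begin

text \<open>If \<open>\<alpha> = root m A\<close> is irreducible, no nonzero rational polynomial of degree below \<open>m\<close>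
  vanishes at \<open>\<alpha>\<close>: one of least degree \<open>d\<close> divides \<open>X\<^sup>m - A\<close>, so all its complex roots have
  modulus \<open>\<alpha>\<close>, and its constant and leading coefficients show that \<open>\<alpha>\<^sup>d\<close> is rational.
  A linear relation gives \<open>\<beta> = p + q\<alpha>\<close> with \<open>q \<noteq> 0\<close>. Then \<open>(p + qX)\<^sup>n - B\<close> vanishes at \<open>\<alpha>\<close>,
  so \<open>m \<le> n\<close>, and \<open>m = n\<close> by symmetry. Subtracting \<open>q\<^sup>n (X\<^sup>n - A)\<close> leaves
  a polynomial of degree below \<open>n\<close> with linear coefficient \<open>n q p\<^sup>n\<^sup>-\<^sup>1\<close>,
  which must vanish; so \<open>p = 0\<close>, and \<open>root n (A / B)\<close> is rational.\<close>

lemma map_poly_of_rat_add: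
  "map_poly (of_rat :: rat \<Rightarrow> 'a::field_char_0) (p + q) = map_poly of_rat p + map_poly of_rat q"
  by (intro poly_eqI) (simp add: coeff_map_poly of_rat_add)

lemma map_poly_of_rat_diff:
  "map_poly (of_rat :: rat \<Rightarrow> 'a::field_char_0) (p - q) = map_poly of_rat p - map_poly of_rat q"
  by (intro poly_eqI) (simp add: coeff_map_poly of_rat_diff)

lemma map_poly_of_rat_mult:
  "map_poly (of_rat :: rat \<Rightarrow> 'a::field_char_0) (p * q) = map_poly of_rat p * map_poly of_rat q"
  by (intro poly_eqI) (simp add: coeff_map_poly coeff_mult of_rat_sum of_rat_mult)

lemma map_poly_of_rat_power:
  "map_poly (of_rat :: rat \<Rightarrow> 'a::field_char_0) (p ^ n) = map_poly of_rat p ^ n"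
  by (induction n) (simp_all add: map_poly_of_rat_mult)

lemma norm_of_rat: "norm (of_rat q :: 'a::real_normed_field) = of_rat \<bar>q\<bar>"
  by (cases q) (simp add: of_rat_rat norm_divide abs_rat)

text \<open>Vieta's formula in absolute value: \<open>p\<close> splits over the complex numbers, and
  evaluating the factorization at 0 gives the leading coefficient times the product of the negated
  roots, each of modulus \<open>r\<close>.\<close>

lemma norm_coeff_0_if_roots_norm_eq:
  fixes p :: "complex poly"
  assumes "p \<noteq> 0" and roots: "\<And>z. poly p z = 0 \<Longrightarrow> norm z = r"
  shows "norm (coeff p 0) = norm (lead_coeff p) * r ^ degree p"
proof -
  obtain Z where Z: "size Z = degree p" "p = smult (lead_coeff p) (\<Prod>x\<in>#Z. [:-x, 1:])"
    using alg_closed_imp_factorization[OF \<open>p \<noteq> 0\<close>] by blast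
  have poly_p: "poly p z = lead_coeff p * (\<Prod>x\<in>#Z. z - x)" for z
    by (subst Z(2)) (simp add: poly_prod_mset)
  have norms: "norm x = r" if "x \<in># Z" for x
  proof (rule roots)
    have "(\<Prod>y\<in>#Z. x - y) = 0"
      using that by (auto simp: prod_mset_zero_iff)
    then show "poly p x = 0"
      by (simp add: poly_p)
  qed
  have "norm (\<Prod>x\<in>#Y. - x) = r ^ size Y" if "\<And>x. x \<in># Y \<Longrightarrow> norm x = r" for Y :: "complex multiset"
    using that by (induction Y) (simp_all add: norm_mult)
  from this[of Z] norms Z(1) have "norm (\<Prod>x\<in>#Z. - x) = r ^ degree p"
    by simp
  with poly_p[of 0] show ?thesis
    by (simp add: poly_0_coeff_0 norm_mult)
qed

text \<open>For \<open>d < m\<close> the radical would equal \<open>root d (of_rat C)\<close>, a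
  radical of smaller index, against irreducibility.\<close>

lemma irreducible_radical_power_eq_rat:
  fixes A C :: rat
  assumes "irreducible_radical m A" "0 < A" "0 < m" "0 < d"
    and eq: "root m (of_rat A) ^ d = of_rat C"
  shows "m \<le> d"
proof (rule ccontr)
  assume "\<not> m \<le> d"
  have pos: "root m (of_rat A) > 0"
    using assms by simp
  then have "0 < C"
    using eq zero_less_power[OF pos, of d] by simp
  moreover have "root m (of_rat A) = root d (of_rat C)"
    using pos \<open>0 < d\<close> by (simp flip: eq add: real_root_power_cancel)
  ultimately show False
    using assms(1) \<open>0 < d\<close> \<open>\<not> m \<le> d\<close> unfolding irreducible_radical_def
    by (auto simp: Suc_le_eq not_le)
qed

lemma irreducible_radical_degree_ge:
  fixes A :: rat and P :: "rat poly"
  assumes irr: "irreducible_radical m A" and "0 < A" "0 < m"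
    and "P \<noteq> 0" "poly (map_poly of_rat P) (root m (of_rat A)) = 0"
  shows "m \<le> degree P"
proof -
  define \<alpha> where "\<alpha> = root m (of_rat A)"
  have "\<alpha> > 0" and \<alpha>_pow: "\<alpha> ^ m = of_rat A"
    using assms by (simp_all add: \<alpha>_def)
  define ann where "ann = (\<lambda>P::rat poly. P \<noteq> 0 \<and> poly (map_poly of_rat P) \<alpha> = 0)"
  have "ann P"
    using assms by (simp add: ann_def \<alpha>_def)
  then obtain D where D: "ann D" and least: "\<And>Q. ann Q \<Longrightarrow> degree D \<le> degree Q"
    using ex_has_least_nat[of ann P degree] by blast
  have "D \<noteq> 0" and D_\<alpha>: "poly (map_poly of_rat D) \<alpha> = 0"
    using D by (auto simp: ann_def)
  \<comment> \<open>Here \<open>X\<close> names the whole binomial with root \<alpha>, not the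
    indeterminate.\<close>
  define X where "X = monom 1 m - [:A:]"
  have poly_X: "poly (map_poly of_rat X) z = z ^ m - of_rat A" for z :: "'a::field_char_0"
    by (simp add: X_def map_poly_of_rat_diff map_poly_monom poly_monom map_poly_pCons)
  have X_eq: "X = D * (X div D) + X mod D"
    by simp
  have "poly (map_poly of_rat X) \<alpha> = poly (map_poly of_rat (X mod D)) \<alpha>"
    by (subst X_eq) (simp only: map_poly_of_rat_add map_poly_of_rat_mult poly_add poly_mult D_\<alpha>
        mult_zero_left add_0)
  then have "poly (map_poly of_rat (X mod D)) \<alpha> = 0"
    by (simp add: poly_X \<alpha>_pow)
  \<comment> \<open>A nonzero remainder would annihilate \<alpha> with degree below that of
    \<open>D\<close>.\<close>
  then have "X mod D = 0"
    using least[of "X mod D"] degree_mod_less[OF \<open>D \<noteq> 0\<close>, of X] by (force simp: ann_def)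
  then have X_factor: "X = D * (X div D)"
    by (simp add: mod_eq_0_iff_dvd)
  define D' :: "complex poly" where "D' = map_poly of_rat D"
  have "norm z = \<alpha>" if "poly D' z = 0" for z
  proof -
    have "poly (map_poly of_rat X) z = 0"
      by (subst X_factor) (simp add: map_poly_of_rat_mult that flip: D'_def)
    then have "z ^ m = of_rat A"
      by (simp add: poly_X)
    then have "norm z ^ m = norm (of_rat A :: complex)"
      by (simp flip: norm_power)
    also have "\<dots> = \<alpha> ^ m"
      using \<open>0 < A\<close> by (simp add: norm_of_rat \<alpha>_pow)
    finally show ?thesis
      using power_eq_imp_eq_base[of "norm z" m \<alpha>] \<open>0 < m\<close> \<open>\<alpha> > 0\<close> by simp
  qed
  moreover have "D' \<noteq> 0" and deg: "degree D' = degree D"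
    using \<open>D \<noteq> 0\<close> by (simp_all add: D'_def map_poly_eq_0_iff degree_map_poly)
  ultimately have "norm (coeff D' 0) = norm (lead_coeff D') * \<alpha> ^ degree D"
    using norm_coeff_0_if_roots_norm_eq[of D' \<alpha>] by simp
  moreover have "norm (coeff D' i) = of_rat \<bar>coeff D i\<bar>" for i
    by (simp add: D'_def coeff_map_poly norm_of_rat)
  ultimately have "\<alpha> ^ degree D = of_rat (\<bar>coeff D 0\<bar> / \<bar>lead_coeff D\<bar>)"
    using \<open>D \<noteq> 0\<close> by (simp add: deg field_simps of_rat_divide)
  \<comment> \<open>Exponent 0 would make the rationality of the power trivial, so constants must be
    excluded.\<close>
  moreover have "degree D > 0"
  proof (rule ccontr)
    assume "\<not> degree D > 0"
    then obtain c where "D = [:c:]"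
      by (auto elim: degree_eq_zeroE)
    then show False
      using \<open>D \<noteq> 0\<close> D_\<alpha> by (simp add: map_poly_pCons)
  qed
  ultimately have "m \<le> degree D"
    using irreducible_radical_power_eq_rat[OF irr] assms by (simp add: \<alpha>_def)
  also have "\<dots> \<le> degree P"
    using least[OF \<open>ann P\<close>] .
  finally show ?thesis .
qed

lemma degree_linear_power_le: "degree ([:p, q:] ^ n :: 'a::idom poly) \<le> n"
  using degree_power_le[of "[:p, q:]" n] by (simp split: if_splits)

lemma irreducible_radical_affine_le:
  fixes A B p q :: rat
  assumes irr: "irreducible_radical m A" and "0 < A" "0 < B" "0 < m" "0 < n"
    and "q \<noteq> 0" and rel: "root n (of_rat B) = of_rat p + of_rat q * root m (of_rat A)"
  shows "m \<le> n"
proof -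
  define P where "P = [:p, q:] ^ n - [:B:]"
  \<comment> \<open>Since \<open>n > 0\<close>, subtracting the constant \<open>B\<close> leaves the
    top coefficient intact.\<close>
  have "coeff P n = q ^ n"
    using \<open>0 < n\<close> by (simp add: P_def coeff_linear_poly_power coeff_pCons split: nat.split)
  then have "P \<noteq> 0"
    using \<open>q \<noteq> 0\<close> by auto
  moreover have "poly (map_poly of_rat P) (root m (of_rat A)) = 0"
    using rel[symmetric] \<open>0 < B\<close> \<open>0 < n\<close>
    by (simp add: P_def map_poly_of_rat_diff map_poly_of_rat_power map_poly_pCons mult.commute)
  ultimately have "m \<le> degree P"
    using irreducible_radical_degree_ge[OF irr] assms by blast
  also have "\<dots> \<le> n"
    unfolding P_def by (intro degree_diff_le degree_linear_power_le) simp
  finally show ?thesis .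
qed

lemma irreducible_radical_affine_eq_0:
  fixes A B p q :: rat
  assumes irr: "irreducible_radical n A" and "0 < A" "0 < B" "1 < n"
    and "q \<noteq> 0" and rel: "root n (of_rat B) = of_rat p + of_rat q * root n (of_rat A)"
  shows "p = 0"
proof (rule ccontr)
  assume "p \<noteq> 0"
  define P where "P = [:p, q:] ^ n - [:B:] - smult (q ^ n) (monom 1 n - [:A:])"
  \<comment> \<open>Since \<open>n > 1\<close>, neither the constants nor the monomial of degree
    \<open>n\<close> reach the linear coefficient.\<close>
  have "coeff P 1 = of_nat n * q * p ^ (n - 1)"
    using \<open>1 < n\<close> by (simp add: P_def coeff_linear_poly_power)
  then have "P \<noteq> 0"
    using \<open>q \<noteq> 0\<close> \<open>p \<noteq> 0\<close> \<open>1 < n\<close> by auto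
  moreover have "poly (map_poly of_rat P) (root n (of_rat A)) = 0"
    using rel[symmetric] \<open>0 < A\<close> \<open>0 < B\<close> \<open>1 < n\<close>
    by (simp add: P_def map_poly_of_rat_diff map_poly_of_rat_power map_poly_pCons map_poly_smult
        map_poly_monom poly_monom of_rat_mult mult.commute)
  ultimately have "n \<le> degree P"
    using irreducible_radical_degree_ge[OF irr] assms by simp
  moreover have "degree P \<le> n"
    unfolding P_def
    by (intro degree_diff_le degree_linear_power_le order.trans[OF degree_smult_le] degree_monom_le)
      simp_all
  \<comment> \<open>The terms of degree \<open>n\<close> cancel, while the two bounds force degree
    exactly \<open>n\<close>; the leading coefficient would be 0.\<close>
  moreover have "coeff P n = 0"
    using \<open>1 < n\<close> by (simp add: P_def coeff_linear_poly_power coeff_pCons split: nat.split)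
  ultimately show False
    using \<open>P \<noteq> 0\<close> by (metis order.antisym leading_coeff_0_iff)
qed

lemma irreducible_radical_not_affine:
  fixes A B p q :: rat
  assumes "0 < A" "0 < B" "1 < m" "1 < n"
    and irr: "irreducible_radical m A" "irreducible_radical n B"
    and ne: "m \<noteq> n \<or> (m = n \<and> root n (of_rat (A / B)) \<notin> \<rat>)" and "q \<noteq> 0"
  shows "root n (of_rat B) \<noteq> of_rat p + of_rat q * root m (of_rat A)"
proof
  assume rel: "root n (of_rat B) = of_rat p + of_rat q * root m (of_rat A)"
  \<comment> \<open>Solving for the other radical gives a relation of the same shape, so the degree
    bound applies in both directions.\<close>
  have "root m (of_rat A) = of_rat (- p / q) + of_rat (1 / q) * root n (of_rat B)"
    using rel \<open>q \<noteq> 0\<close> by (simp add: of_rat_divide of_rat_minus field_simps)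
  then have "n \<le> m"
    using irreducible_radical_affine_le[OF irr(2), where q = "1 / q"] assms by simp
  moreover have "m \<le> n"
    using irreducible_radical_affine_le[OF irr(1) _ _ _ _ \<open>q \<noteq> 0\<close> rel] assms by simp
  ultimately have "m = n"
    by simp
  then have "p = 0"
    using irreducible_radical_affine_eq_0[of n A B q p] assms rel by simp
  then have "root n (of_rat (A / B)) = of_rat (1 / q)"
    using rel \<open>m = n\<close> assms by (simp add: of_rat_divide real_root_divide)
  then show False
    using ne \<open>m = n\<close> by simp
qed

text \<open>A rational value is a rational first power, which would force
  \<open>m \<le> 1\<close>.\<close>

lemma irreducible_radical_irrational:
  fixes A c :: rat
  assumes "irreducible_radical m A" "0 < A" "1 < m"
  shows "root m (of_rat A) \<noteq> of_rat c"
  using irreducible_radical_power_eq_rat[OF assms(1,2), of 1 c] assms by auto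

(* Independence of a set does not see repetitions, so independence of the three numbers
   as a family also requires them to be pairwise distinct. *)

theorem mainTheorem4:
  fixes A B :: rat and m n :: nat
  assumes "0 < A" and "0 < B"
    and "1 < m" and "1 < n"
    and "irreducible_radical m A" and "irreducible_radical n B"
    and "m \<noteq> n \<or> (m = n \<and> root n (of_rat (A / B)) \<notin> \<rat>)"
  shows "distinct [1, root m (of_rat A), root n (of_rat B)] \<and>
         rat_real.independent {1, root m (of_rat A), root n (of_rat B)}"
proof -
  define \<alpha> \<beta> where "\<alpha> = root m (of_rat A)" and "\<beta> = root n (of_rat B)"
  have \<alpha>: "\<alpha> \<noteq> of_rat c" and \<beta>: "\<beta> \<noteq> of_rat c" for c
    using irreducible_radical_irrational assms unfolding \<alpha>_def \<beta>_def by blast+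
  have affine: "\<beta> \<noteq> of_rat p + of_rat q * \<alpha>" if "q \<noteq> 0" for p q
    using irreducible_radical_not_affine[OF assms that] unfolding \<alpha>_def \<beta>_def .
  have dist: "distinct [1, \<alpha>, \<beta>]"
    using \<alpha>[of 1] \<beta>[of 1] affine[of 1 0] by auto
  have "u = 0 \<and> v = 0 \<and> w = 0"
    if rel: "of_rat u + (of_rat v * \<alpha> + of_rat w * \<beta>) = 0" for u v w
  proof (cases "w = 0")
    case True
    have "v = 0"
    proof (rule ccontr)
      assume "v \<noteq> 0"
      then have "\<alpha> = of_rat (- u / v)"
        using rel True by (simp add: of_rat_divide of_rat_minus field_simps)
      then show False
        using \<alpha> by blast
    qed
    then show ?thesis
      using rel True by simp
  next
    \<comment> \<open>Solving for \<beta> contradicts \<open>affine\<close> unless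
      \<open>v = 0\<close>, and then \<beta> would be rational.\<close>
    case False
    then have \<beta>_eq: "\<beta> = of_rat (- u / w) + of_rat (- v / w) * \<alpha>"
      using rel by (simp add: of_rat_divide of_rat_minus field_simps)
    then have "v = 0"
      using affine[of "- v / w" "- u / w"] False by auto
    then show ?thesis
      using \<beta>_eq \<beta>[of "- u / w"] by simp
  qed
  \<comment> \<open>Distinctness lets the sum over the set unfold into exactly the three terms
    treated above.\<close>
  then have "rat_real.independent {1, \<alpha>, \<beta>}"
    using dist by (auto simp: rat_real.dependent_finite)
  with dist show ?thesis
    unfolding \<alpha>_def \<beta>_def by simp
qed

end
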